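(* Let $F$ be a CNF formula over $n$ Boolean variables and let $S=S(F)\subseteq\{0,1\}^n$ be its set of satisfying assignments. For each $i\in\{0,1,\ldots,n\}$ let $\mathcal{D}_i$ be an arbitrary $i$-uniform distribution on subsets of $\{0,1\}^n$. Consider the following randomized procedure. (1) Choose $\delta\in(0,1/3]$ and $\theta>0$, and receive as input any number $L$ with $0\le L\le |S|$. (2) If $|S|<4/\delta$, return $|S|$ and stop. (3) Let $\ell=\max\{0,\lfloor\log_2(\delta L/4)\rfloor\}$. (4) Let $B$ be any number with $B\ge \max_{\ell\le i\le n}\mathrm{Boost}(\mathcal{D}_i,2^i)$ (for instance $B=1$ if all $\mathcal{D}_i$, $\ell\le i\le n$, have pairwise independent membership). (5) Set $\xi=8/\delta$, $b=\lceil \xi+2(\xi+\xi^2(B-1))\rceil$ and $t=\lceil (2b^2/9)\ln(2n/\theta)\rceil$. (6) For each $i=\ell,\ldots,n$ and each $j=1,\ldots,t$, sample $R_{i,j}\sim\mathcal{D}_i$ (all samples mutually independent), let $Y_{i,j}=\min\{b,|S\cap R_{i,j}|\}$, $Z_i=\sum_{j=1}^t Y_{i,j}$ and $A_i=Z_i/t$. (7) Let $j^*=\max\{i\ge \ell: A_i\ge (1-\delta)(4/\delta)\}$ and return $\max\{L, A_{j^*}2^{j^*}\}$. Then the probability that the output of this procedure does not lie in the range $[(1-\delta)|S|,(1+\delta)|S|]$ (counting as a failure the event that the set defining $j^*$ is empty) is at most $\theta$.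
   Context: A distribution $\mathcal{D}$ on subsets of $\{0,1\}^n$ is $i$-uniform if, for $R\sim\mathcal{D}$, $\Pr[\sigma\in R]=2^{-i}$ for every $\sigma\in\{0,1\}^n$. For such a distribution and $M\ge 1$, $$\mathrm{Boost}(\mathcal{D},M)=\max_{S\subseteq\{0,1\}^n,\ |S|\ge M}\ \frac{1}{|S|(|S|-1)}\sum_{\sigma,\tau\in S,\ \sigma\ne\tau}\frac{\Pr[\sigma,\tau\in R]}{\Pr[\sigma\in R]\Pr[\tau\in R]},$$ where $R\sim\mathcal{D}$ (sets $S$ with $|S|\le 1$, for which the expression is undefined, are excluded from the maximum).
   Formalization: The formal theorem additionally requires B ≥ 1 in step (4) (when |S| ≥ 4/δ); without it b can be negative and the procedure can always fail, e.g. n=6, S={0,1}^6, δ=1/4, L=64, D_i uniform on subsets of size 64/2^i, B=60/63. *)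

theory Defs
  imports "HOL-Probability.Probability"
begin

datatype literal = Pos nat | Neg nat

fun var_of :: "literal \<Rightarrow> nat" where
  "var_of (Pos v) = v"
| "var_of (Neg v) = v"

text \<open>A formula is a conjunction of clauses, a clause is a disjunction of literals;
  the variables are \<open>0, \<dots>, n - 1\<close>.\<close>

type_synonym cnf = "literal list list"

type_synonym assignment = "bool list"

definition cnf_over :: "nat \<Rightarrow> cnf \<Rightarrow> bool" where
  "cnf_over n F \<longleftrightarrow> (\<forall>C\<in>set F. \<forall>l\<in>set C. var_of l < n)"

fun lit_true :: "assignment \<Rightarrow> literal \<Rightarrow> bool" where
  "lit_true \<sigma> (Pos v) \<longleftrightarrow> \<sigma> ! v"
| "lit_true \<sigma> (Neg v) \<longleftrightarrow> \<not> \<sigma> ! v"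

definition cnf_true :: "assignment \<Rightarrow> cnf \<Rightarrow> bool" where
  "cnf_true \<sigma> F \<longleftrightarrow> (\<forall>C\<in>set F. \<exists>l\<in>set C. lit_true \<sigma> l)"

definition cube :: "nat \<Rightarrow> assignment set" where
  "cube n = {\<sigma>. length \<sigma> = n}"

definition sat_set :: "nat \<Rightarrow> cnf \<Rightarrow> assignment set" where
  "sat_set n F = {\<sigma> \<in> cube n. cnf_true \<sigma> F}"

definition i_uniform :: "nat \<Rightarrow> nat \<Rightarrow> assignment set pmf \<Rightarrow> bool" where
  "i_uniform n i \<D> \<longleftrightarrow>
     set_pmf \<D> \<subseteq> Pow (cube n) \<and>
     (\<forall>\<sigma>\<in>cube n. measure_pmf.prob \<D> {R. \<sigma> \<in> R} = 1 / 2 ^ i)"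

text \<open>
  The maximum ranges over a finite set, which is nonempty exactly if \<open>n \<ge> 1\<close> and \<open>M \<le> 2 ^ n\<close>.
\<close>

definition boost :: "nat \<Rightarrow> assignment set pmf \<Rightarrow> nat \<Rightarrow> real" where
  "boost n \<D> M =
     Max ((\<lambda>S. 1 / (real (card S) * (real (card S) - 1)) *
             (\<Sum>\<sigma>\<in>S. \<Sum>\<tau>\<in>S - {\<sigma>}.
                measure_pmf.prob \<D> {R. \<sigma> \<in> R \<and> \<tau> \<in> R} /
                (measure_pmf.prob \<D> {R. \<sigma> \<in> R} * measure_pmf.prob \<D> {R. \<tau> \<in> R})))
          ` {S. S \<subseteq> cube n \<and> M \<le> card S \<and> 2 \<le> card S})"

text \<open>
  For \<open>L = 0\<close> the logarithm would be \<open>- \<infinity>\<close>, giving level \<open>0\<close>; the convention \<open>log 2 0 = 0\<close> gives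
  the same level.
\<close>

definition start_level :: "real \<Rightarrow> real \<Rightarrow> nat" where
  "start_level \<delta> L = nat (max 0 \<lfloor>log 2 (\<delta> * L / 4)\<rfloor>)"

definition cutoff :: "real \<Rightarrow> real \<Rightarrow> int" where
  "cutoff \<delta> B = (let \<xi> = 8 / \<delta> in \<lceil>\<xi> + 2 * (\<xi> + \<xi>\<^sup>2 * (B - 1))\<rceil>)"

text \<open>
  The ceiling can only be negative if \<open>\<theta> > 2 * n\<close>; then no samples are drawn.
\<close>

definition num_samples :: "nat \<Rightarrow> real \<Rightarrow> real \<Rightarrow> real \<Rightarrow> nat" where
  "num_samples n \<delta> \<theta> B =
     nat \<lceil>2 * (real_of_int (cutoff \<delta> B))\<^sup>2 / 9 * ln (2 * real n / \<theta>)\<rceil>"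

text \<open>\<open>R (i, j)\<close> is the outcome of the \<open>j\<close>-th sample at level \<open>i\<close>.\<close>

definition level_avg ::
  "assignment set \<Rightarrow> int \<Rightarrow> nat \<Rightarrow> (nat \<times> nat \<Rightarrow> assignment set) \<Rightarrow> nat \<Rightarrow> real" where
  "level_avg S b t R i =
     real_of_int (\<Sum>j\<in>{1..t}. min b (int (card (S \<inter> R (i, j))))) / real t"

text \<open>\<open>None\<close> is the failure that no level reaches the threshold.\<close>

definition estimate :: "nat \<Rightarrow> real \<Rightarrow> real \<Rightarrow> (nat \<Rightarrow> real) \<Rightarrow> real option" where
  "estimate n \<delta> L A =
     (let J = {i \<in> {start_level \<delta> L..n}. (1 - \<delta>) * (4 / \<delta>) \<le> A i}
      in if J = {} then None else Some (max L (A (Max J) * 2 ^ Max J)))"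

definition count_proc ::
  "nat \<Rightarrow> assignment set \<Rightarrow> (nat \<Rightarrow> assignment set pmf) \<Rightarrow>
   real \<Rightarrow> real \<Rightarrow> real \<Rightarrow> real \<Rightarrow> real option pmf" where
  "count_proc n S \<D> \<delta> \<theta> L B =
     (if real (card S) < 4 / \<delta> then return_pmf (Some (real (card S)))
      else
        (let b = cutoff \<delta> B; t = num_samples n \<delta> \<theta> B
         in map_pmf (\<lambda>R. estimate n \<delta> L (level_avg S b t R))
              (Pi_pmf ({start_level \<delta> L..n} \<times> {1..t}) {} (\<lambda>(i, j). \<D> i))))"

end

theory Submission
  imports Defs
begin

text \<open>
  Write \<open>\<mu> i = |S| / 2 ^ i\<close> for the expected size of \<open>S \<inter> R\<close> at level \<open>i\<close>, and let \<open>m\<close> be the last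
  level with \<open>\<mu> m \<ge> 4 / \<delta>\<close>; then \<open>\<mu> m < 8 / \<delta>\<close> and \<open>m + 3 \<le> n\<close>. By the boost bound the variance of
  \<open>|S \<inter> R|\<close> at the levels \<open>m\<close> and \<open>m + 1\<close> is at most \<open>V = \<xi> + \<xi>\<^sup>2 * (B - 1)\<close>, so cutting off at
  \<open>b \<ge> \<xi> + 2 * V\<close> lowers the expectation by at most \<open>1 / 8\<close>. Hoeffding's inequality makes every
  one-sided deviation of \<open>A i\<close> by \<open>3 / 2\<close> have probability at most \<open>\<theta> / (2 * n)\<close>. If \<open>A m\<close> and
  \<open>A (m + 1)\<close> deviate in neither direction and the later \<open>A i\<close> not upwards, then the levels above
  \<open>m + 1\<close> stay below the threshold, \<open>m\<close> reaches it, and the estimates from both \<open>m\<close> and \<open>m + 1\<close> are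
  accurate. These are at most \<open>n + 3 \<le> 2 * n\<close> bad events.
\<close>

section \<open>First and second moments of \<open>card (S \<inter> R)\<close>\<close>

lemma finite_cube [simp]: "finite (cube n)"
  and card_cube: "card (cube n) = 2 ^ n"
  using finite_lists_length_eq[of "UNIV :: bool set" n] card_lists_length_eq[of "UNIV :: bool set" n]
  by (simp_all add: cube_def)

lemma finite_set_pmf_i_uniform: "i_uniform n i D \<Longrightarrow> finite (set_pmf D)"
  unfolding i_uniform_def by (meson finite_Pow_iff finite_cube finite_subset)

lemma card_Int_eq_sum_indicator:
  "finite S \<Longrightarrow> real (card (S \<inter> R)) = (\<Sum>\<sigma>\<in>S. indicator {R. \<sigma> \<in> R} R)"
  by (simp add: indicator_def sum.If_cases Int_def)

lemma integrable_indicator_pmf [simp]: "integrable (measure_pmf D) (indicat_real A)"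
  by (rule measure_pmf.integrable_const_bound[where B = 1]) auto

lemma expectation_card_Int:
  assumes "finite S"
  shows "measure_pmf.expectation D (\<lambda>R. real (card (S \<inter> R))) =
    (\<Sum>\<sigma>\<in>S. measure_pmf.prob D {R. \<sigma> \<in> R})"
  unfolding card_Int_eq_sum_indicator[OF assms]
  by (subst Bochner_Integration.integral_sum) auto

lemma expectation_card_Int_squared:
  assumes "finite S"
  shows "measure_pmf.expectation D (\<lambda>R. (real (card (S \<inter> R)))\<^sup>2) =
    (\<Sum>\<sigma>\<in>S. \<Sum>\<tau>\<in>S. measure_pmf.prob D {R. \<sigma> \<in> R \<and> \<tau> \<in> R})"
proof -
  have "(real (card (S \<inter> R)))\<^sup>2 = (\<Sum>\<sigma>\<in>S. \<Sum>\<tau>\<in>S. indicator {R. \<sigma> \<in> R \<and> \<tau> \<in> R} R)" for R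
    unfolding card_Int_eq_sum_indicator[OF assms] power2_eq_square sum_product
    by (intro sum.cong refl) (auto simp: indicator_def)
  then show ?thesis
    by (simp add: Bochner_Integration.integral_sum)
qed

lemma i_uniform_expectation:
  assumes "i_uniform n i D" "S \<subseteq> cube n"
  shows "measure_pmf.expectation D (\<lambda>R. real (card (S \<inter> R))) = real (card S) / 2 ^ i"
proof -
  have "finite S"
    using assms(2) finite_cube finite_subset by blast
  moreover have "(\<Sum>\<sigma>\<in>S. measure_pmf.prob D {R. \<sigma> \<in> R}) = (\<Sum>\<sigma>\<in>S. 1 / 2 ^ i)"
    using assms by (intro sum.cong) (auto simp: i_uniform_def)
  ultimately show ?thesis
    by (simp add: expectation_card_Int)
qed

text \<open>\<open>S\<close> itself competes in the maximum defining \<open>boost\<close>, so its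
  normalised pair sum is at most \<open>B\<close>; uniformity turns each denominator in that sum
  into \<open>1 / (2 ^ i)\<^sup>2\<close>.\<close>

lemma i_uniform_pair_sum_le:
  assumes unif: "i_uniform n i D" and S: "S \<subseteq> cube n" "2 ^ i \<le> card S" "2 \<le> card S"
    and B: "boost n D (2 ^ i) \<le> B"
  shows "(\<Sum>\<sigma>\<in>S. \<Sum>\<tau>\<in>S - {\<sigma>}. measure_pmf.prob D {R. \<sigma> \<in> R \<and> \<tau> \<in> R})
    \<le> B * (real (card S) * (real (card S) - 1)) / (2 ^ i)\<^sup>2"
proof -
  define N where "N = real (card S) * (real (card S) - 1)"
  define f where "f S = 1 / (real (card S) * (real (card S) - 1)) *
    (\<Sum>\<sigma>\<in>S. \<Sum>\<tau>\<in>S - {\<sigma>}. measure_pmf.prob D {R. \<sigma> \<in> R \<and> \<tau> \<in> R} /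
       (measure_pmf.prob D {R. \<sigma> \<in> R} * measure_pmf.prob D {R. \<tau> \<in> R}))" for S
  define P where "P = (\<Sum>\<sigma>\<in>S. \<Sum>\<tau>\<in>S - {\<sigma>}. measure_pmf.prob D {R. \<sigma> \<in> R \<and> \<tau> \<in> R})"
  have "N > 0"
    using S(3) by (simp add: N_def)
  have "finite {S. S \<subseteq> cube n \<and> 2 ^ i \<le> card S \<and> 2 \<le> card S}"
    by (rule finite_subset[of _ "Pow (cube n)"]) auto
  then have "f S \<le> boost n D (2 ^ i)"
    unfolding boost_def f_def[symmetric] using S by (intro Max_ge finite_imageI imageI) auto
  also have "f S = 1 / N * (\<Sum>\<sigma>\<in>S. \<Sum>\<tau>\<in>S - {\<sigma>}. measure_pmf.prob D {R. \<sigma> \<in> R \<and> \<tau> \<in> R} * (2 ^ i)\<^sup>2)"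
    unfolding f_def N_def using unif S(1)
    by (intro arg_cong2[where f = "(*)"] refl sum.cong)
      (auto simp: i_uniform_def subset_iff power2_eq_square)
  also have "\<dots> = P * (2 ^ i)\<^sup>2 / N"
    by (simp add: P_def sum_distrib_right)
  also note B
  finally show ?thesis
    using \<open>N > 0\<close> unfolding P_def[symmetric] N_def[symmetric] by (simp add: field_simps)
qed

text \<open>In the second moment the diagonal pairs contribute \<open>\<mu>\<close> and the others
  at most \<open>B * \<mu>\<^sup>2\<close>; subtracting the squared mean leaves the bound.\<close>

lemma i_uniform_variance_le:
  assumes unif: "i_uniform n i D" and S: "S \<subseteq> cube n" "2 ^ i \<le> card S" "2 \<le> card S"
    and B: "boost n D (2 ^ i) \<le> B" "1 \<le> B"
  defines "\<mu> \<equiv> real (card S) / 2 ^ i"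
  shows "measure_pmf.variance D (\<lambda>R. real (card (S \<inter> R))) \<le> \<mu> + \<mu>\<^sup>2 * (B - 1)"
proof -
  let ?X = "\<lambda>R. real (card (S \<inter> R))"
  let ?P = "\<lambda>\<sigma> \<tau>. measure_pmf.prob D {R. \<sigma> \<in> R \<and> \<tau> \<in> R}"
  have fin: "finite S"
    using S(1) finite_cube finite_subset by blast
  note fin' = finite_set_pmf_i_uniform[OF unif]
  have "measure_pmf.expectation D (\<lambda>R. (?X R)\<^sup>2) = (\<Sum>\<sigma>\<in>S. ?P \<sigma> \<sigma> + (\<Sum>\<tau>\<in>S - {\<sigma>}. ?P \<sigma> \<tau>))"
    unfolding expectation_card_Int_squared[OF fin] using fin
    by (intro sum.cong refl sum.remove) auto
  also have "\<dots> = \<mu> + (\<Sum>\<sigma>\<in>S. \<Sum>\<tau>\<in>S - {\<sigma>}. ?P \<sigma> \<tau>)"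
    using i_uniform_expectation[OF unif S(1)] expectation_card_Int[OF fin, of D]
    by (simp add: sum.distrib \<mu>_def)
  also have "\<dots> \<le> \<mu> + B * (real (card S) * (real (card S) - 1)) / (2 ^ i)\<^sup>2"
    using i_uniform_pair_sum_le[OF unif S B(1)] by simp
  also have "\<dots> \<le> \<mu> + B * (real (card S) * real (card S)) / (2 ^ i)\<^sup>2"
    using B(2) by (intro add_left_mono divide_right_mono mult_left_mono) auto
  also have "\<dots> = \<mu> + B * \<mu>\<^sup>2"
    by (simp add: \<mu>_def power2_eq_square)
  finally have "measure_pmf.expectation D (\<lambda>R. (?X R)\<^sup>2) \<le> \<mu> + B * \<mu>\<^sup>2" .
  moreover have "measure_pmf.variance D ?X = measure_pmf.expectation D (\<lambda>R. (?X R)\<^sup>2) - \<mu>\<^sup>2"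
    by (subst measure_pmf.variance_eq)
      (auto intro: integrable_measure_pmf_finite[OF fin'] simp: i_uniform_expectation[OF unif S(1)] \<mu>_def)
  ultimately show ?thesis
    by (simp add: algebra_simps)
qed

section \<open>Truncation and concentration\<close>

text \<open>Truncation loses the excess of \<open>X\<close> over \<open>b\<close>, which is
  dominated pointwise by a parabola centred at the mean; scaled by \<open>1 / (8 * V)\<close>, the
  parabola has expectation at most \<open>1 / 8\<close>.\<close>

lemma expectation_min_ge:
  fixes X :: "'a \<Rightarrow> real"
  assumes fin: "finite (set_pmf D)" and "0 < V" and var: "measure_pmf.variance D X \<le> V"
    and b: "measure_pmf.expectation D X + 2 * V \<le> b"
  shows "measure_pmf.expectation D X - 1 / 8 \<le> measure_pmf.expectation D (\<lambda>x. min b (X x))"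
proof -
  let ?E = "measure_pmf.expectation D"
  note int = integrable_measure_pmf_finite[OF fin]
  define \<mu> where "\<mu> = ?E X"
  have *: "X x - (X x - \<mu>)\<^sup>2 / (8 * V) \<le> min b (X x)" for x
  proof -
    \<comment> \<open>\<open>y - a \<le> y\<^sup>2 / (4 * a)\<close> for \<open>y = X x - \<mu>\<close> and \<open>a = 2 * V\<close>\<close>
    have "0 \<le> ((X x - \<mu>) - 4 * V)\<^sup>2"
      by simp
    then have "((X x - \<mu>) - 2 * V) * (8 * V) \<le> (X x - \<mu>)\<^sup>2"
      by (simp add: power2_eq_square algebra_simps)
    then have "(X x - \<mu>) - 2 * V \<le> (X x - \<mu>)\<^sup>2 / (8 * V)"
      using \<open>0 < V\<close> by (simp add: pos_le_divide_eq)
    moreover have "0 \<le> (X x - \<mu>)\<^sup>2 / (8 * V)"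
      using \<open>0 < V\<close> by simp
    ultimately show ?thesis
      using b by (simp add: \<mu>_def min_def)
  qed
  have "\<mu> - 1 / 8 \<le> \<mu> - ?E (\<lambda>x. (X x - \<mu>)\<^sup>2) / (8 * V)"
    using var \<open>0 < V\<close> by (simp add: \<mu>_def field_simps)
  also have "\<dots> = ?E (\<lambda>x. X x - (X x - \<mu>)\<^sup>2 / (8 * V))"
    by (simp add: int \<mu>_def)
  also have "\<dots> \<le> ?E (\<lambda>x. min b (X x))"
    by (intro integral_mono int *)
  finally show ?thesis
    by (simp add: \<mu>_def)
qed

text \<open>\<open>I\<close> will index the samples of all levels and \<open>J\<close> those of a
  single level, which are independent with common law \<open>q\<close>. Hoeffding's inequality for
  their sum is rescaled to the average.\<close>

lemma Pi_pmf_Hoeffding_avg: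
  fixes f :: "'b \<Rightarrow> real"
  assumes I: "finite I" "J \<subseteq> I" "J \<noteq> {}" and p: "\<And>k. k \<in> J \<Longrightarrow> p k = q"
    and f: "\<And>x. f x \<in> {0..b}" and "0 < b" "0 \<le> \<epsilon>"
  shows "measure_pmf.prob (Pi_pmf I d p)
      {R. measure_pmf.expectation q f + \<epsilon> \<le> (\<Sum>k\<in>J. f (R k)) / real (card J)}
      \<le> exp (- 2 * real (card J) * \<epsilon>\<^sup>2 / b\<^sup>2)" (is ?ge)
    and "measure_pmf.prob (Pi_pmf I d p)
      {R. (\<Sum>k\<in>J. f (R k)) / real (card J) \<le> measure_pmf.expectation q f - \<epsilon>}
      \<le> exp (- 2 * real (card J) * \<epsilon>\<^sup>2 / b\<^sup>2)" (is ?le)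
proof -
  define M where "M = Pi_pmf I d p"
  define \<mu> where "\<mu> = measure_pmf.expectation q f"
  define c where "c = real (card J)"
  have fin: "finite J"
    using I finite_subset by blast
  then have "c > 0"
    using I(3) by (simp add: c_def card_gt_0_iff)
  have exp_k: "measure_pmf.expectation M (\<lambda>R. f (R k)) = \<mu>" if "k \<in> J" for k
  proof -
    have "map_pmf (\<lambda>R. R k) M = q"
      using that I p by (auto simp: M_def Pi_pmf_component)
    then show ?thesis
      unfolding \<mu>_def by (metis integral_map_pmf)
  qed
  have "prob_space.indep_vars (measure_pmf M) (\<lambda>_. count_space UNIV) (\<lambda>k R. R k) J"
    unfolding M_def
    by (rule prob_space.indep_vars_subset[OF _ indep_vars_Pi_pmf I(2)])
      (use I in \<open>auto simp: measure_pmf.prob_space_axioms\<close>)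
  then have indep: "prob_space.indep_vars (measure_pmf M) (\<lambda>_. borel) (\<lambda>k R. f (R k)) J"
    by (rule prob_space.indep_vars_compose2[OF measure_pmf.prob_space_axioms]) auto
  interpret H: Hoeffding_ineq "measure_pmf M" J "\<lambda>k R. f (R k)" "\<lambda>_. 0" "\<lambda>_. b"
    "\<Sum>k\<in>J. measure_pmf.expectation M (\<lambda>R. f (R k))"
    by unfold_locales (use fin indep f in auto)
  have sum_exp: "(\<Sum>k\<in>J. measure_pmf.expectation M (\<lambda>R. f (R k))) = c * \<mu>"
    by (simp add: exp_k c_def)
  \<comment> \<open>The sum deviates by \<open>c * \<epsilon>\<close>; one factor \<open>c\<close>
    cancels against the \<open>c\<close> equal summands below.\<close>
  have exponent: "- 2 * (c * \<epsilon>)\<^sup>2 / (\<Sum>k\<in>J. (b - 0)\<^sup>2) = - 2 * c * \<epsilon>\<^sup>2 / b\<^sup>2"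
    using \<open>c > 0\<close> by (simp add: c_def[symmetric] power2_eq_square)
  have pos: "0 < (\<Sum>k\<in>J. (b - 0)\<^sup>2)" "0 \<le> c * \<epsilon>"
    using \<open>c > 0\<close> \<open>0 < b\<close> \<open>0 \<le> \<epsilon>\<close> by (simp_all add: c_def[symmetric])
  have ge_iff: "\<mu> + \<epsilon> \<le> x / c \<longleftrightarrow> c * \<mu> + c * \<epsilon> \<le> x" for x
    using \<open>c > 0\<close> by (simp add: field_simps)
  have le_iff: "x / c \<le> \<mu> - \<epsilon> \<longleftrightarrow> x \<le> c * \<mu> - c * \<epsilon>" for x
    using \<open>c > 0\<close> by (simp add: field_simps)
  show ?ge
    using H.Hoeffding_ineq_ge[OF pos(2,1)] unfolding exponent sum_exp
    by (simp add: M_def[symmetric] \<mu>_def[symmetric] c_def[symmetric] ge_iff)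
  show ?le
    using H.Hoeffding_ineq_le[OF pos(2,1)] unfolding exponent sum_exp
    by (simp add: M_def[symmetric] \<mu>_def[symmetric] c_def[symmetric] le_iff)
qed

section \<open>Levels and the deterministic analysis of the estimate\<close>

text \<open>Applied with \<open>L'\<close> the true count, this places the level singled out in the
  analysis at or above the first sampled level. \<open>L = 0\<close> is separate because
  monotonicity of the logarithm needs positive arguments.\<close>

lemma start_level_mono:
  assumes "0 < \<delta>" "0 \<le> L" "L \<le> L'" "4 / \<delta> \<le> L'"
  shows "start_level \<delta> L \<le> start_level \<delta> L'"
proof (cases "L = 0")
  case False
  then show ?thesis
    using assms unfolding start_level_def
    by (intro nat_mono max.mono floor_mono order.refl) (auto intro!: log_mono)
qed (simp add: start_level_def log_def)

text \<open>Since \<open>\<delta> * L / 4\<close> is at least 1, the maximum with 0 is inactive and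
  the floor traps this number between consecutive powers of two.\<close>

lemma start_level_bounds:
  assumes "0 < \<delta>" "4 / \<delta> \<le> L"
  shows "4 / \<delta> \<le> L / 2 ^ start_level \<delta> L" "L / 2 ^ start_level \<delta> L < 8 / \<delta>"
proof -
  define x where "x = \<delta> * L / 4"
  have "1 \<le> x"
    using assms by (simp add: x_def field_simps)
  define m where "m = start_level \<delta> L"
  have "0 \<le> log 2 x"
    using \<open>1 \<le> x\<close> by simp
  then have m: "real m \<le> log 2 x" "log 2 x < real m + 1"
    unfolding m_def start_level_def x_def[symmetric] by linarith+
  have "2 ^ m \<le> x"
    using m(1) \<open>1 \<le> x\<close> by (simp add: le_log_iff powr_realpow)
  moreover have "x < 2 ^ (m + 1)"
    using m(2) \<open>1 \<le> x\<close> by (simp add: log_less_iff powr_add powr_realpow)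
  ultimately show "4 / \<delta> \<le> L / 2 ^ start_level \<delta> L" "L / 2 ^ start_level \<delta> L < 8 / \<delta>"
    using assms(1) unfolding m_def[symmetric] x_def by (simp_all add: field_simps)
qed

text \<open>By \<open>near\<close>, level \<open>m\<close> reaches the threshold, and
  \<open>low\<close> excludes everything beyond \<open>Suc m\<close>. Whether \<open>Suc m\<close>
  reaches it is left open, so accuracy is demanded at both levels.\<close>

lemma estimate_accurate:
  fixes A :: "nat \<Rightarrow> real"
  assumes \<delta>: "0 < \<delta>" "\<delta> < 1" and L: "L \<le> s" "0 \<le> s"
    and m: "start_level \<delta> L \<le> m" "m \<le> n" "4 / \<delta> \<le> s / 2 ^ m"
    and near: "\<And>i. i \<in> {m, Suc m} \<Longrightarrow> \<bar>A i - s / 2 ^ i\<bar> \<le> \<delta> * (s / 2 ^ i)"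
    and low: "\<And>i. Suc m < i \<Longrightarrow> i \<le> n \<Longrightarrow> A i < (1 - \<delta>) * (4 / \<delta>)"
  shows "\<exists>x. estimate n \<delta> L A = Some x \<and> x \<in> {(1 - \<delta>) * s..(1 + \<delta>) * s}"
proof -
  define J where "J = {i \<in> {start_level \<delta> L..n}. (1 - \<delta>) * (4 / \<delta>) \<le> A i}"
  have "finite J"
    by (simp add: J_def)
  have "(1 - \<delta>) * (4 / \<delta>) \<le> (1 - \<delta>) * (s / 2 ^ m)"
    using m(3) \<delta> by (intro mult_left_mono) auto
  also have "\<dots> \<le> A m"
    using near[of m] unfolding left_diff_distrib by (simp add: abs_le_iff)
  finally have "m \<in> J"
    using m by (simp add: J_def)
  then have "J \<noteq> {}" "m \<le> Max J" "Max J \<in> J"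
    using \<open>finite J\<close> by (auto intro: Max_in)
  then have "Max J \<le> Suc m"
    using low[of "Max J"] by (auto simp: J_def not_less[symmetric])
  with \<open>m \<le> Max J\<close> have "Max J \<in> {m, Suc m}"
    by auto
  then have near': "\<bar>A (Max J) - s / 2 ^ Max J\<bar> \<le> \<delta> * (s / 2 ^ Max J)"
    by (rule near)
  then have "\<bar>A (Max J) - s / 2 ^ Max J\<bar> * 2 ^ Max J \<le> \<delta> * (s / 2 ^ Max J) * 2 ^ Max J"
    by (rule mult_right_mono) simp
  then have "\<bar>A (Max J) * 2 ^ Max J - s\<bar> \<le> \<delta> * s"
    by (simp add: abs_mult_pos left_diff_distrib)
  \<comment> \<open>The maximum with \<open>L\<close> is harmless: it cannot lower the estimate, and
    \<open>L \<le> s\<close> stays within the upper limit.\<close>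
  moreover have "0 \<le> \<delta> * s"
    using L \<delta> by simp
  then have "L \<le> (1 + \<delta>) * s"
    unfolding distrib_right using L by linarith
  ultimately have "max L (A (Max J) * 2 ^ Max J) \<in> {(1 - \<delta>) * s..(1 + \<delta>) * s}"
    by (auto simp: abs_le_iff algebra_simps le_max_iff_disj)
  then show ?thesis
    using \<open>J \<noteq> {}\<close> unfolding estimate_def J_def[symmetric] Let_def by simp
qed

section \<open>Deviation and bias of the level averages\<close>

text \<open>\<open>l\<close> stands for \<open>ln (2 * n / \<theta>)\<close>. For deviation
  \<open>3 / 2\<close> the Hoeffding exponent is \<open>9 * t / (2 * b\<^sup>2)\<close> in absolute
  value, which explains the factor \<open>2 / 9\<close> in the sample size.\<close>

lemma level_avg_deviation:
  fixes D :: "nat \<Rightarrow> assignment set pmf" and S :: "assignment set"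
  assumes "a \<le> i" "i \<le> n" "0 < t" "0 < b"
    and t: "2 * (real_of_int b)\<^sup>2 / 9 * l \<le> real t"
  defines "M \<equiv> Pi_pmf ({a..n} \<times> {1..t}) {} (\<lambda>(i, j). D i)"
    and "\<nu> \<equiv> measure_pmf.expectation (D i) (\<lambda>R. min (real_of_int b) (real (card (S \<inter> R))))"
  shows "measure_pmf.prob M {R. \<nu> + 3 / 2 \<le> level_avg S b t R i} \<le> exp (- l)"
    and "measure_pmf.prob M {R. level_avg S b t R i \<le> \<nu> - 3 / 2} \<le> exp (- l)"
proof -
  let ?f = "\<lambda>R. min (real_of_int b) (real (card (S \<inter> R)))"
  let ?J = "{i} \<times> {1..t}"
  have avg: "level_avg S b t R i = (\<Sum>k\<in>?J. ?f (R k)) / real (card ?J)" for R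
    using sum.cartesian_product[of "\<lambda>i j. ?f (R (i, j))" "{1..t}" "{i}"]
    by (simp add: level_avg_def of_int_min card_cartesian_product split_def)
  have f: "?f R \<in> {0..real_of_int b}" for R
    using \<open>0 < b\<close> by auto
  have "- 2 * real (card ?J) * (3 / 2)\<^sup>2 / (real_of_int b)\<^sup>2 \<le> - l"
    using t \<open>0 < b\<close> by (simp add: card_cartesian_product field_simps power2_eq_square)
  then have e: "exp (- 2 * real (card ?J) * (3 / 2)\<^sup>2 / (real_of_int b)\<^sup>2) \<le> exp (- l)"
    by simp
  have "?J \<subseteq> {a..n} \<times> {1..t}" "?J \<noteq> {}"
    using assms(1-3) by auto
  note H = Pi_pmf_Hoeffding_avg[where f = ?f and q = "D i" and b = "real_of_int b" and \<epsilon> = "3 / 2"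
      and p = "\<lambda>(i, j). D i" and d = "{}", OF _ this _ f]
  show "measure_pmf.prob M {R. \<nu> + 3 / 2 \<le> level_avg S b t R i} \<le> exp (- l)"
    unfolding avg M_def \<nu>_def by (rule order.trans[OF H(1) e]) (use \<open>0 < b\<close> in auto)
  show "measure_pmf.prob M {R. level_avg S b t R i \<le> \<nu> - 3 / 2} \<le> exp (- l)"
    unfolding avg M_def \<nu>_def by (rule order.trans[OF H(2) e]) (use \<open>0 < b\<close> in auto)
qed

text \<open>As \<open>\<xi>\<close> bounds the mean, \<open>V\<close> bounds the variance, and
  \<open>cutoff\<close> is \<open>\<xi> + 2 * V\<close> rounded up: the margin that
  \<open>expectation_min_ge\<close> asks for.\<close>

lemma i_uniform_truncated_expectation:
  assumes unif: "i_uniform n i D" and S: "S \<subseteq> cube n" "2 ^ i \<le> card S" "2 \<le> card S"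
    and B: "boost n D (2 ^ i) \<le> B" "1 \<le> B" and \<delta>: "0 < \<delta>" "real (card S) / 2 ^ i \<le> 8 / \<delta>"
  shows "real (card S) / 2 ^ i - 1 / 8 \<le>
    measure_pmf.expectation D (\<lambda>R. min (real_of_int (cutoff \<delta> B)) (real (card (S \<inter> R))))"
proof -
  define \<mu> where "\<mu> = real (card S) / 2 ^ i"
  define \<xi> where "\<xi> = 8 / \<delta>"
  define V where "V = \<xi> + \<xi>\<^sup>2 * (B - 1)"
  have "0 < \<xi>" "0 \<le> \<mu>" "\<mu> \<le> \<xi>"
    using \<delta> by (simp_all add: \<xi>_def \<mu>_def)
  have "0 < V"
    using \<open>0 < \<xi>\<close> B(2) by (simp add: V_def add_pos_nonneg)
  have "measure_pmf.variance D (\<lambda>R. real (card (S \<inter> R))) \<le> \<mu> + \<mu>\<^sup>2 * (B - 1)"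
    using i_uniform_variance_le[OF unif S B] by (simp add: \<mu>_def)
  also have "\<dots> \<le> V"
    unfolding V_def using \<open>\<mu> \<le> \<xi>\<close> \<open>0 \<le> \<mu>\<close> B(2) by (intro add_mono mult_right_mono power_mono) auto
  finally have var: "measure_pmf.variance D (\<lambda>R. real (card (S \<inter> R))) \<le> V" .
  have "\<xi> + 2 * V \<le> real_of_int (cutoff \<delta> B)"
    by (simp add: cutoff_def V_def \<xi>_def Let_def)
  then show ?thesis
    using expectation_min_ge[OF finite_set_pmf_i_uniform[OF unif] \<open>0 < V\<close> var] \<open>\<mu> \<le> \<xi>\<close>
    by (simp add: i_uniform_expectation[OF unif S(1)] \<mu>_def)
qed

text \<open>Truncation only lowers the mean. This side serves every level up to \<open>n\<close>,
  including those with \<open>2 ^ i > card S\<close>.\<close>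

lemma i_uniform_truncated_expectation_le:
  assumes unif: "i_uniform n i D" and "S \<subseteq> cube n"
  shows "measure_pmf.expectation D (\<lambda>R. min b (real (card (S \<inter> R)))) \<le> real (card S) / 2 ^ i"
  unfolding i_uniform_expectation[OF assms, symmetric]
  by (intro integral_mono integrable_measure_pmf_finite finite_set_pmf_i_uniform[OF unif]) auto

section \<open>Case distinction and union bound\<close>

theorem theorem3:
  fixes n :: nat and F :: cnf and \<D> :: "nat \<Rightarrow> assignment set pmf"
    and \<delta> \<theta> L B :: real
  defines "S \<equiv> sat_set n F"
  assumes "cnf_over n F"
    and "\<And>i. i \<le> n \<Longrightarrow> i_uniform n i (\<D> i)"
    and "0 < \<delta>" and "\<delta> \<le> 1 / 3" and "0 < \<theta>"
    and "0 \<le> L" and "L \<le> real (card S)"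
    and "4 / \<delta> \<le> real (card S) \<Longrightarrow>
           (MAX i\<in>{start_level \<delta> L..n}. boost n (\<D> i) (2 ^ i)) \<le> B"
    and "4 / \<delta> \<le> real (card S) \<Longrightarrow> 1 \<le> B"
  shows "measure_pmf.prob (count_proc n S \<D> \<delta> \<theta> L B)
           {r. case r of
                 None \<Rightarrow> True
               | Some x \<Rightarrow> x \<notin> {(1 - \<delta>) * real (card S)..(1 + \<delta>) * real (card S)}}
         \<le> \<theta>"
proof -
  let ?bad = "{r. case r of None \<Rightarrow> True
     | Some x \<Rightarrow> x \<notin> {(1 - \<delta>) * real (card S)..(1 + \<delta>) * real (card S)}}"
  note unif = assms(3) and \<delta> = assms(4,5)
  \<comment> \<open>In the last case \<open>\<theta> < 1\<close> keeps the logarithm in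
    \<open>num_samples\<close> positive, so samples are really drawn.\<close>
  consider "1 \<le> \<theta>" | "real (card S) < 4 / \<delta>" | "\<theta> < 1" "4 / \<delta> \<le> real (card S)"
    by linarith
  then show ?thesis
  proof cases
    case 1
    then show ?thesis
      using measure_pmf.prob_le_1 order.trans by blast
  next
    case 2
    have "Some (real (card S)) \<notin> ?bad"
      using \<delta> by (auto simp: algebra_simps)
    then show ?thesis
      using 2 \<open>0 < \<theta>\<close> by (simp add: count_proc_def measure_return_pmf)
  next
    case 3
    define s where "s = real (card S)"
    define a where "a = start_level \<delta> L"
    \<comment> \<open>Computed from the true count \<open>s\<close> instead of \<open>L\<close>;
      this level belongs to the analysis only.\<close>
    define m where "m = start_level \<delta> s"
    define b where "b = cutoff \<delta> B"
    define t where "t = num_samples n \<delta> \<theta> B"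
    define M where "M = Pi_pmf ({a..n} \<times> {1..t}) {} (\<lambda>(i, j). \<D> i)"
    define \<nu> where
      "\<nu> i = measure_pmf.expectation (\<D> i) (\<lambda>R. min (real_of_int b) (real (card (S \<inter> R))))" for i
    define up where "up i = {R. \<nu> i + 3 / 2 \<le> level_avg S b t R i}" for i
    define down where "down i = {R. level_avg S b t R i \<le> \<nu> i - 3 / 2}" for i
    have S: "S \<subseteq> cube n"
      by (auto simp: S_def sat_set_def)
    have s: "4 / \<delta> \<le> s" "L \<le> s"
      using 3 assms by (auto simp: s_def)
    have "12 \<le> 4 / \<delta>"
      using \<delta> by (simp add: field_simps)
    have B: "1 \<le> B" "\<And>i. i \<in> {a..n} \<Longrightarrow> boost n (\<D> i) (2 ^ i) \<le> B"
    proof -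
      show "boost n (\<D> i) (2 ^ i) \<le> B" if "i \<in> {a..n}" for i
      proof -
        have "boost n (\<D> i) (2 ^ i) \<le> (MAX i\<in>{a..n}. boost n (\<D> i) (2 ^ i))"
          using that by (intro Max_ge) auto
        then show ?thesis
          using assms(9)[OF 3(2)] by (simp add: a_def)
      qed
    qed (use assms(10) 3 in auto)
    have m: "4 / \<delta> \<le> s / 2 ^ m" "s / 2 ^ m < 8 / \<delta>"
      using start_level_bounds[OF \<delta>(1) s(1)] by (simp_all add: m_def)
    have "a \<le> m"
      unfolding a_def m_def using assms s by (intro start_level_mono) auto
    \<comment> \<open>\<open>12 * 2 ^ m \<le> 2 ^ n\<close> and 12 is at least 8. Hence
      \<open>Suc m\<close> is a sampled level, and \<open>n\<close> is at least 3.\<close>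
    have "m + 3 \<le> n"
    proof -
      have "12 * 2 ^ m \<le> s"
        using m(1) \<open>12 \<le> 4 / \<delta>\<close> order.trans[of 12 "4 / \<delta>" "s / 2 ^ m"] by (simp add: pos_le_divide_eq)
      also have "s \<le> 2 ^ n"
        using card_mono[OF finite_cube S] by (simp add: s_def card_cube)
      finally have "(2::real) ^ (m + 3) \<le> 2 ^ n"
        by (simp add: power_add) (smt (verit) zero_le_power)
      then show ?thesis
        by (subst (asm) power_increasing_iff) auto
    qed
    have "0 < b"
    proof -
      have "0 < 8 / \<delta> + 2 * (8 / \<delta> + (8 / \<delta>)\<^sup>2 * (B - 1))"
        using \<delta> B(1) by (intro add_pos_nonneg mult_nonneg_nonneg add_nonneg_nonneg) auto
      then show ?thesis
        by (simp add: b_def cutoff_def Let_def)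
    qed
    define l where "l = ln (2 * real n / \<theta>)"
    have "0 < l"
      unfolding l_def using \<open>m + 3 \<le> n\<close> \<open>0 < \<theta>\<close> 3(1) by (intro ln_gt_zero) (simp add: field_simps)
    have t: "2 * (real_of_int b)\<^sup>2 / 9 * l \<le> real t"
      unfolding t_def num_samples_def b_def l_def by (rule real_nat_ceiling_ge)
    moreover have "0 < 2 * (real_of_int b)\<^sup>2 / 9 * l"
      using \<open>0 < b\<close> \<open>0 < l\<close> by simp
    ultimately have "0 < t"
      by linarith
    have exp_l: "exp (- l) = \<theta> / (2 * real n)"
      using \<open>m + 3 \<le> n\<close> \<open>0 < \<theta>\<close> by (simp add: l_def exp_minus)
    have dev: "measure_pmf.prob M (up i) \<le> \<theta> / (2 * real n)"
        "measure_pmf.prob M (down i) \<le> \<theta> / (2 * real n)" if "m \<le> i" "i \<le> n" for i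
      using level_avg_deviation[OF _ that(2) \<open>0 < t\<close> \<open>0 < b\<close> t, of a \<D> S] that \<open>a \<le> m\<close>
      by (simp_all add: M_def up_def down_def \<nu>_def exp_l)
    have \<nu>_le: "\<nu> i \<le> s / 2 ^ i" if "i \<le> n" for i
      unfolding \<nu>_def s_def by (rule i_uniform_truncated_expectation_le[OF unif[OF that] S])
    \<comment> \<open>The mean lies between \<open>4 / \<delta>\<close> and
      \<open>8 / \<delta>\<close> at level \<open>m\<close>, and it halves at
      \<open>Suc m\<close>.\<close>
    have halves: "s / 2 ^ i \<le> 8 / \<delta>" "2 / \<delta> \<le> s / 2 ^ i" if "i \<in> {m, Suc m}" for i
      using that m \<delta> by (auto simp: field_simps)
    have \<nu>_ge: "s / 2 ^ i - 1 / 8 \<le> \<nu> i" if i: "i \<in> {m, Suc m}" for i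
    proof -
      \<comment> \<open>The boost bound speaks about sets of size at least \<open>2 ^ i\<close>, so
        \<open>S\<close> has to be that large.\<close>
      have "1 \<le> s / 2 ^ i"
        using halves(2)[OF i] \<open>12 \<le> 4 / \<delta>\<close> by linarith
      then have "real (2 ^ i) \<le> real (card S)"
        by (simp add: s_def pos_le_divide_eq)
      then have "2 ^ i \<le> card S"
        by linarith
      moreover have "2 \<le> card S"
        using s(1) \<open>12 \<le> 4 / \<delta>\<close> by (simp add: s_def)
      moreover have "i \<in> {a..n}"
        using i \<open>m + 3 \<le> n\<close> \<open>a \<le> m\<close> by auto
      ultimately show ?thesis
        unfolding \<nu>_def s_def b_def
        using i_uniform_truncated_expectation[OF unif S _ _ B(2) B(1) \<delta>(1)] halves(1)[OF i] 
        by (simp add: s_def)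
    qed
    \<comment> \<open>Levels beyond \<open>Suc m\<close> only have to miss the threshold, so
      downward deviations matter at \<open>m\<close> and \<open>Suc m\<close> alone.\<close>
    define Bad where "Bad = (\<Union>i\<in>{m..n}. up i) \<union> (down m \<union> down (Suc m))"
    have good: "estimate n \<delta> L (level_avg S b t R) \<notin> ?bad" if R: "R \<notin> Bad" for R
    proof -
      let ?A = "level_avg S b t R"
      have up: "?A i < s / 2 ^ i + 3 / 2" if "m \<le> i" "i \<le> n" for i
      proof -
        have "R \<notin> up i"
          using R that by (auto simp: Bad_def)
        then show ?thesis
          using \<nu>_le[OF that(2)] by (simp add: up_def)
      qed
      have "\<bar>?A i - s / 2 ^ i\<bar> \<le> \<delta> * (s / 2 ^ i)" if i: "i \<in> {m, Suc m}" for i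
      proof -
        \<comment> \<open>The allowed error is at least 2, while sampling error and truncation bias
          add up to at most \<open>3 / 2 + 1 / 8\<close>.\<close>
        have "2 \<le> \<delta> * (s / 2 ^ i)"
          using mult_left_mono[OF halves(2)[OF i], of \<delta>] \<delta> by simp
        moreover have "?A i < s / 2 ^ i + 3 / 2"
          using i \<open>m + 3 \<le> n\<close> by (intro up) auto
        moreover have "\<nu> i - 3 / 2 < ?A i"
          using i R by (auto simp: Bad_def down_def)
        ultimately show ?thesis
          using \<nu>_ge[OF i] by linarith
      qed
      \<comment> \<open>With \<open>y = 2 / \<delta>\<close>, the average is below
        \<open>y + 3 / 2\<close> and the threshold is \<open>2 * y - 4\<close>; \<open>y\<close> is
        at least 6, and \<open>11 / 2\<close> would be the break-even point.\<close>
      moreover have "?A i < (1 - \<delta>) * (4 / \<delta>)" if i: "Suc m < i" "i \<le> n" for i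
      proof -
        have "s / 2 ^ i \<le> s / 2 ^ (m + 2)"
          using i by (intro divide_left_mono power_increasing) (auto simp: s_def)
        also have "\<dots> < 2 / \<delta>"
          using m(2) by (simp add: field_simps)
        finally have "?A i < 2 / \<delta> + 3 / 2"
          using up[of i] i by simp
        moreover have "(1 - \<delta>) * (4 / \<delta>) = 4 / \<delta> - 4"
          using \<delta>(1) by (simp add: field_simps)
        moreover have "4 / \<delta> = 2 * (2 / \<delta>)"
          by simp
        ultimately show ?thesis
          using \<open>12 \<le> 4 / \<delta>\<close> by linarith
      qed
      ultimately have "\<exists>x. estimate n \<delta> L ?A = Some x \<and> x \<in> {(1 - \<delta>) * s..(1 + \<delta>) * s}"
        using \<delta> s m \<open>a \<le> m\<close> \<open>m + 3 \<le> n\<close>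
        by (intro estimate_accurate[where m = m]) (auto simp: a_def s_def)
      then show ?thesis
        by (auto simp: s_def)
    qed
    have "measure_pmf.prob (count_proc n S \<D> \<delta> \<theta> L B) ?bad =
        measure_pmf.prob M {R. estimate n \<delta> L (level_avg S b t R) \<in> ?bad}"
      using 3 by (simp add: count_proc_def Let_def vimage_def M_def a_def b_def t_def)
    also have "\<dots> \<le> measure_pmf.prob M Bad"
      using good by (intro measure_pmf.finite_measure_mono) auto
    also have "\<dots> \<le> measure_pmf.prob M (\<Union>i\<in>{m..n}. up i) +
        (measure_pmf.prob M (down m) + measure_pmf.prob M (down (Suc m)))"
      unfolding Bad_def
      by (intro order.trans[OF measure_Un_le] add_left_mono measure_Un_le) auto
    also have "\<dots> \<le> (\<Sum>i\<in>{m..n}. \<theta> / (2 * real n)) + (\<theta> / (2 * real n) + \<theta> / (2 * real n))"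
      using \<open>m + 3 \<le> n\<close>
      by (intro add_mono dev order.trans[OF measure_pmf.finite_measure_subadditive_finite] sum_mono) auto
    \<comment> \<open>There are \<open>n - m + 1\<close> upward events and two downward ones;
      \<open>n + 3 \<le> 2 * n\<close> because \<open>n\<close> is at least 3.\<close>
    also have "\<dots> = real (n + 3 - m) * (\<theta> / (2 * real n))"
      unfolding sum_constant distrib_right[symmetric] mult_2[symmetric]
      using \<open>m + 3 \<le> n\<close> by (simp add: of_nat_diff distrib_right[symmetric] del: times_divide_eq_right)
    also have "\<dots> \<le> real (2 * n) * (\<theta> / (2 * real n))"
      using \<open>m + 3 \<le> n\<close> \<open>0 < \<theta>\<close> by (intro mult_right_mono) auto
    also have "\<dots> = \<theta>"
      using \<open>m + 3 \<le> n\<close> by simp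
    finally show ?thesis .
  qed
qed

end
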